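(* Let $n\in\mathbb N$ and suppose there exists $\mu_n^*\in\operatorname{argmin}_{\mathbb R^N_{\ge0}}E_n$ such that $$\left(\mu_n^*+\operatorname{Ker}\operatorname{Hess}E_n(\mu_n^* )\right)\cap\mathbb R^N_{\ge0}=\{\mu_n^*\}.$$ Then $\mu_n^*$ is the unique minimizer of $E_n$ (on $\mathbb R^N_{\ge0}$).
   Context: Let $\Omega=(0,1)^d$ and let $f\in L^\infty(\Omega)$ satisfy $\int_\Omega f\,dx=0$ and $\operatorname{conv}(\operatorname{supp} f)\subset\subset\Omega$. $(\mathcal T^n)_{n\in\mathbb N}$ is a sequence of nested simplicial triangulations of $\Omega$ obtained by successive uniform refinements, $\mathcal T^n=\{T^n_1,\dots,T^n_N\}$ ($N$ depends on $n$). $\mathcal W_n$ is the space of continuous functions on $\Omega$, affine on each simplex of $\mathcal T^{n+1}$, with zero integral over $\Omega$; $\phi_1,\dots,\phi_M$ is a basis of it. $(\delta_n)$ is a monotone sequence of positive reals with $\delta_n\downarrow0$. Put $A^{(i)}=\left(\int_{T_i^n}\nabla\phi_p\cdot\nabla\phi_q\,dx\right)_{p,q}$, $A(\mu)=\sum_{i=1}^N(\mu_i+\delta_n)A^{(i)}$, $\boldsymbol f=\left(\int_\Omega f\phi_p\,dx\right)_p$, $a=(|T_1^n|,\dots,|T_N^n|)$. The functional $E_n$ is $E_n(\mu)=\boldsymbol f^{\,t}A(\mu)^{-1}\boldsymbol f+\langle\mu,a\rangle$ for $\mu\in\mathbb R^N_{\ge0}$, and $+\infty$ otherwise. Derivatives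 of $E_n$ at points of $\mathbb R^N_{\ge0}$ (including $\operatorname{Hess}E_n$) are those of the real analytic function given by the same formula on $\{\mu\in\mathbb R^N:\mu_i>-\delta_n\ \forall i\}$. *)

theory Defs
  imports "HOL-Analysis.Analysis"
begin

text \<open>The domain is the open unit cube of dimension \<open>d = CARD('d) \<ge> 1\<close>. Functions on it are total
  functions of which only the values on the cube matter.\<close>

definition unit_cube :: "(real ^ 'd) set" where
  "unit_cube = box 0 1"

section \<open>The datum\<close>

definition L_infinity_on :: "(real ^ 'd) set \<Rightarrow> (real ^ 'd \<Rightarrow> real) \<Rightarrow> bool" where
  "L_infinity_on S f \<longleftrightarrow>
     f \<in> borel_measurable (lebesgue_on S) \<and> (\<exists>C. AE x in lebesgue_on S. \<bar>f x\<bar> \<le> C)"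

text \<open>The support of a class of functions modulo null sets: the complement (in \<open>S\<close>) of the largest
  open set on which \<open>f\<close> vanishes almost everywhere.\<close>

definition ess_support_on :: "(real ^ 'd) set \<Rightarrow> (real ^ 'd \<Rightarrow> real) \<Rightarrow> (real ^ 'd) set" where
  "ess_support_on S f =
     {x \<in> S. \<forall>U. open U \<and> x \<in> U \<longrightarrow> \<not> (AE y in lebesgue_on S. y \<in> U \<longrightarrow> f y = 0)}"

definition compactly_contained :: "'a::topological_space set \<Rightarrow> 'a set \<Rightarrow> bool" where
  "compactly_contained S U \<longleftrightarrow> compact (closure S) \<and> closure S \<subseteq> U"

section \<open>Triangulations\<close>

text \<open>Simplices are closed; the library predicate \<open>triangulation\<close> says that the family is finite and
  that any two members meet in a common (possibly empty) face.\<close>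

definition triangulation_of_cube :: "(real ^ 'd) set set \<Rightarrow> bool" where
  "triangulation_of_cube \<T> \<longleftrightarrow>
     triangulation \<T> \<and> (\<forall>T\<in>\<T>. int CARD('d) simplex T) \<and> \<Union>\<T> = closure unit_cube"

definition vertices :: "(real ^ 'd) set \<Rightarrow> (real ^ 'd) set" where
  "vertices T = {v. v extreme_point_of T}"

text \<open>Every simplex of the coarse triangulation is cut, by halving its edges, into \<open>2 ^ d\<close> simplices
  of equal volume, whose vertices are vertices (\<open>v = w\<close> below) or edge midpoints of the coarse
  simplex. The number \<open>2 ^ d\<close> of children is a consequence of the volume condition. In dimension 2
  this comprises joining the edge midpoints; in higher dimension it leaves open the choice of the
  interior diagonals.\<close>

definition uniform_refinement :: "(real ^ 'd) set set \<Rightarrow> (real ^ 'd) set set \<Rightarrow> bool" where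
  "uniform_refinement \<T> \<T>' \<longleftrightarrow>
     (\<forall>S\<in>\<T>'. \<exists>T\<in>\<T>. S \<subseteq> T \<and>
        vertices S \<subseteq> {midpoint v w | v w. v \<in> vertices T \<and> w \<in> vertices T} \<and>
        measure lebesgue S = measure lebesgue T / 2 ^ CARD('d))"

section \<open>Finite element space\<close>

definition P1_zero_mean :: "(real ^ 'd) set set \<Rightarrow> (real ^ 'd \<Rightarrow> real) set" where
  "P1_zero_mean \<T> =
     {u. continuous_on unit_cube u \<and>
         (\<forall>T\<in>\<T>. \<exists>a b. \<forall>x \<in> T \<inter> unit_cube. u x = a \<bullet> x + b) \<and>
         (LINT x:unit_cube|lebesgue. u x) = 0}"

text \<open>Linear independence and spanning, with functions identified when they agree on \<open>S\<close>.\<close>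

definition basis_on ::
    "(real ^ 'd) set \<Rightarrow> (real ^ 'd \<Rightarrow> real) set \<Rightarrow> ('m::finite \<Rightarrow> real ^ 'd \<Rightarrow> real) \<Rightarrow> bool" where
  "basis_on S W \<phi> \<longleftrightarrow>
     range \<phi> \<subseteq> W \<and>
     (\<forall>c. (\<forall>x\<in>S. (\<Sum>p\<in>UNIV. c p * \<phi> p x) = 0) \<longrightarrow> (\<forall>p. c p = 0)) \<and>
     (\<forall>u\<in>W. \<exists>c. \<forall>x\<in>S. u x = (\<Sum>p\<in>UNIV. c p * \<phi> p x))"

section \<open>Gradient and Hessian\<close>

definition grad :: "(real ^ 'n \<Rightarrow> real) \<Rightarrow> real ^ 'n \<Rightarrow> real ^ 'n" where
  "grad F x = (\<chi> i. frechet_derivative F (at x) (axis i 1))"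

definition hess :: "(real ^ 'n \<Rightarrow> real) \<Rightarrow> real ^ 'n \<Rightarrow> real ^ 'n ^ 'n" where
  "hess F x = jacobian (grad F) (at x)"

section \<open>The discrete energy\<close>

text \<open>Below, \<open>\<tau> :: 'n \<Rightarrow> _\<close> enumerates the simplices of the coarse mesh, \<open>\<phi> :: 'm \<Rightarrow> _\<close> is the
  basis of the finite element space on the fine mesh, and \<open>\<delta>\<close> is a positive real. A member of
  \<open>P1_zero_mean\<close> is differentiable off a null set, so the value of \<open>grad\<close> elsewhere is irrelevant.\<close>

definition stiffness ::
    "('m \<Rightarrow> real ^ 'd \<Rightarrow> real) \<Rightarrow> (real ^ 'd) set \<Rightarrow> real ^ 'm ^ 'm" where
  "stiffness \<phi> T = (\<chi> p q. LINT x:T|lebesgue. grad (\<phi> p) x \<bullet> grad (\<phi> q) x)"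

definition weighted_stiffness ::
    "('n \<Rightarrow> (real ^ 'd) set) \<Rightarrow> ('m \<Rightarrow> real ^ 'd \<Rightarrow> real) \<Rightarrow> real \<Rightarrow> real ^ 'n \<Rightarrow> real ^ 'm ^ 'm" where
  "weighted_stiffness \<tau> \<phi> \<delta> \<mu> = (\<Sum>i\<in>UNIV. (\<mu> $ i + \<delta>) *\<^sub>R stiffness \<phi> (\<tau> i))"

definition load :: "('m \<Rightarrow> real ^ 'd \<Rightarrow> real) \<Rightarrow> (real ^ 'd \<Rightarrow> real) \<Rightarrow> real ^ 'm" where
  "load \<phi> f = (\<chi> p. LINT x:unit_cube|lebesgue. f x * \<phi> p x)"

definition volumes :: "('n \<Rightarrow> (real ^ 'd) set) \<Rightarrow> real ^ 'n" where
  "volumes \<tau> = (\<chi> i. measure lebesgue (\<tau> i))"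

text \<open>The analytic formula, meaningful where \<open>\<mu> $ i > - \<delta>\<close> for all \<open>i\<close>; derivatives of the energy are
  derivatives of this function.\<close>

definition energy_formula ::
    "('n \<Rightarrow> (real ^ 'd) set) \<Rightarrow> ('m::finite \<Rightarrow> real ^ 'd \<Rightarrow> real) \<Rightarrow> real \<Rightarrow> (real ^ 'd \<Rightarrow> real) \<Rightarrow>
     real ^ 'n \<Rightarrow> real" where
  "energy_formula \<tau> \<phi> \<delta> f \<mu> =
     load \<phi> f \<bullet> (matrix_inv (weighted_stiffness \<tau> \<phi> \<delta> \<mu>) *v load \<phi> f) + \<mu> \<bullet> volumes \<tau>"

definition nonneg_orthant :: "(real ^ 'n) set" where
  "nonneg_orthant = {\<mu>. \<forall>i. 0 \<le> \<mu> $ i}"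

definition energy ::
    "('n \<Rightarrow> (real ^ 'd) set) \<Rightarrow> ('m::finite \<Rightarrow> real ^ 'd \<Rightarrow> real) \<Rightarrow> real \<Rightarrow> (real ^ 'd \<Rightarrow> real) \<Rightarrow>
     real ^ 'n \<Rightarrow> ereal" where
  "energy \<tau> \<phi> \<delta> f \<mu> =
     (if \<mu> \<in> nonneg_orthant then ereal (energy_formula \<tau> \<phi> \<delta> f \<mu>) else \<infinity>)"

definition argmin_on :: "'a set \<Rightarrow> ('a \<Rightarrow> 'b::order) \<Rightarrow> 'a set" where
  "argmin_on S F = {x. is_arg_min F (\<lambda>x. x \<in> S) x}"

end

theory Submission
  imports Defs
begin

text \<open>Completing the square gives \<open>b \<bullet> A\<inverse> b = 2 b \<bullet> w - w \<bullet> A w + (w - u) \<bullet> A (w - u)\<close> for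
  \<open>u = A\<inverse> b\<close> and every \<open>w\<close>. Taking for \<open>w\<close> the solution at the midpoint of two minimizers
  shows that both minimizers \<open>\<mu>\<close>, \<open>\<nu>\<close> have the same solution \<open>u\<close>. Hence \<open>u\<close> solves the system
  at every point of the line through \<open>\<mu>\<close> and \<open>\<nu>\<close>; the gradient of the energy, which depends on
  \<open>\<mu>\<close> only through \<open>u\<close>, is constant there, so \<open>\<nu> - \<mu>\<close> lies in the kernel of the Hessian.
  The matrices are positive definite because a piecewise affine function with vanishing gradient
  takes finitely many values on the connected cube, hence is constant, and has mean zero.\<close>

section \<open>Energies of positive definite matrix pencils\<close>

lemma differentiable_real_prod:
  fixes g :: "'i \<Rightarrow> 'a::real_normed_vector \<Rightarrow> real"
  assumes "\<And>i. i \<in> I \<Longrightarrow> g i differentiable (at x)"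
  shows "(\<lambda>x. \<Prod>i\<in>I. g i x) differentiable (at x)"
proof -
  obtain g' where "\<And>i. i \<in> I \<Longrightarrow> (g i has_derivative g' i) (at x)"
    using assms unfolding differentiable_def by metis
  then show ?thesis
    unfolding differentiable_def by (blast intro: has_derivative_prod)
qed

lemma differentiable_det:
  fixes B :: "'a::real_normed_vector \<Rightarrow> real ^ 'm ^ 'm"
  assumes "\<And>i j. (\<lambda>x. B x $ i $ j) differentiable (at x)"
  shows "(\<lambda>x. det (B x)) differentiable (at x)"
  unfolding det_def
  by (auto intro!: differentiable_sum differentiable_mult differentiable_real_prod
      differentiable_const assms simp: finite_permutations)

lemma differentiable_vec_nth:
  fixes g :: "'a::real_normed_vector \<Rightarrow> real ^ 'm"
  assumes "\<And>i. (\<lambda>x. g x $ i) differentiable (at x)"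
  shows "g differentiable (at x)"
  using assms by (auto simp: differentiable_componentwise_within[of g] Basis_vec_def inner_axis)

lemma matrix_inv_works:
  assumes "invertible B"
  shows "B ** matrix_inv B = mat 1" "matrix_inv B ** B = mat 1"
  using someI_ex[OF assms[unfolded invertible_def]] by (simp_all add: matrix_inv_def)

text \<open>Single matrices \<open>M i\<close> may be singular, as a stiffness matrix of one simplex
  can be; only their common null space is required to be trivial.\<close>

locale stiffness_pencil =
  fixes M :: "'n::finite \<Rightarrow> real ^ 'm ^ 'm" and \<delta> :: real and b :: "real ^ 'm"
    and a :: "real ^ 'n"
  assumes sym: "\<And>i. transpose (M i) = M i"
    and psd: "\<And>i w. 0 \<le> w \<bullet> (M i *v w)"
    and definite: "\<And>w. (\<And>i. w \<bullet> (M i *v w) = 0) \<Longrightarrow> w = 0"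
    and delta_pos: "0 < \<delta>"
begin

definition A :: "real ^ 'n \<Rightarrow> real ^ 'm ^ 'm" where
  "A \<mu> = (\<Sum>i\<in>UNIV. (\<mu> $ i + \<delta>) *\<^sub>R M i)"

definition u :: "real ^ 'n \<Rightarrow> real ^ 'm" where
  "u \<mu> = matrix_inv (A \<mu>) *v b"

definition E :: "real ^ 'n \<Rightarrow> real" where
  "E \<mu> = b \<bullet> u \<mu> + \<mu> \<bullet> a"

text \<open>An open neighbourhood of the orthant on which all weights
  \<open>\<mu> $ i + \<delta>\<close> stay positive, so that derivatives exist also at boundary
  points of the orthant.\<close>

definition D :: "(real ^ 'n) set" where
  "D = {\<mu>. \<forall>i. - \<delta> < \<mu> $ i}"

lemma open_D: "open D"
proof -
  have "D = (\<Inter>i. {\<mu>. - \<delta> < \<mu> $ i})"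
    by (auto simp: D_def)
  then show ?thesis
    by (auto intro!: open_INT open_Collect_less continuous_intros)
qed

lemma nonneg_orthant_subset_D: "nonneg_orthant \<subseteq> D"
proof
  fix x :: "real ^ 'n" assume x: "x \<in> nonneg_orthant"
  have "- \<delta> < x $ i" for i
    using x delta_pos by (simp add: nonneg_orthant_def less_le_trans[of _ 0])
  then show "x \<in> D" by (auto simp: D_def)
qed

lemma A_mult: "A \<mu> *v w = (\<Sum>i\<in>UNIV. (\<mu> $ i + \<delta>) *\<^sub>R (M i *v w))"
proof -
  have "(\<Sum>i\<in>I. (\<mu> $ i + \<delta>) *\<^sub>R M i) *v w = (\<Sum>i\<in>I. (\<mu> $ i + \<delta>) *\<^sub>R (M i *v w))" for I
    by (induction I rule: infinite_finite_induct)
      (auto simp: matrix_vector_mult_add_rdistrib scaleR_matrix_vector_assoc)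
  then show ?thesis by (simp add: A_def)
qed

lemma M_adjoint: "w \<bullet> (M i *v z) = z \<bullet> (M i *v w)"
  by (metis sym dot_lmul_matrix inner_commute transpose_matrix_vector)

lemma A_adjoint: "w \<bullet> (A \<mu> *v z) = z \<bullet> (A \<mu> *v w)"
  by (simp add: A_mult inner_sum_right M_adjoint[of w])

lemma A_pos:
  assumes "\<mu> \<in> D" "w \<noteq> 0"
  shows "0 < w \<bullet> (A \<mu> *v w)"
proof -
  have pos: "0 < \<mu> $ i + \<delta>" for i
  proof -
    have "- \<delta> < \<mu> $ i" using assms(1) by (simp add: D_def)
    then show ?thesis by linarith
  qed
  have eq: "w \<bullet> (A \<mu> *v w) = (\<Sum>i\<in>UNIV. (\<mu> $ i + \<delta>) * (w \<bullet> (M i *v w)))"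
    by (simp add: A_mult inner_sum_right)
  obtain i where "w \<bullet> (M i *v w) \<noteq> 0"
    using definite assms(2) by blast
  then have "0 < (\<mu> $ i + \<delta>) * (w \<bullet> (M i *v w))"
    using psd[of w i] pos[of i] by simp
  then show ?thesis
    unfolding eq by (intro sum_pos2[of _ i]) (auto intro!: mult_nonneg_nonneg psd less_imp_le[OF pos])
qed

lemma invertible_A: "\<mu> \<in> D \<Longrightarrow> invertible (A \<mu>)"
  unfolding invertible_left_inverse matrix_left_invertible_ker
  using A_pos by fastforce

lemma A_u: "\<mu> \<in> D \<Longrightarrow> A \<mu> *v u \<mu> = b"
  using matrix_inv_works(1)[OF invertible_A] by (simp add: u_def matrix_vector_mul_assoc)

lemma u_unique: "\<mu> \<in> D \<Longrightarrow> A \<mu> *v w = b \<Longrightarrow> u \<mu> = w"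
  using matrix_inv_works(2)[OF invertible_A] by (auto simp: u_def matrix_vector_mul_assoc)

text \<open>Cramer's rule writes each component of \<open>u\<close> on \<open>D\<close> as a
  quotient of determinants whose entries are affine in \<open>\<mu>\<close>, with nonvanishing
  denominator.\<close>

lemma u_differentiable:
  assumes "\<mu> \<in> D"
  shows "u differentiable (at \<mu>)"
proof -
  have nz: "det (A \<nu>) \<noteq> 0" if "\<nu> \<in> D" for \<nu>
    using invertible_A[OF that] by (simp add: invertible_det_nz)
  have A_diff: "(\<lambda>\<nu>. A \<nu> $ i $ j) differentiable (at \<nu>)" for i j \<nu>
    unfolding A_def
    by (auto intro!: differentiable_sum differentiable_mult differentiable_add
        bounded_linear_imp_differentiable[OF bounded_linear_vec_nth])
  have col: "(\<lambda>\<nu>. (\<chi> i j. if j = k then b $ i else A \<nu> $ i $ j) $ i $ j) differentiable (at \<mu>)" for i j k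
    by (cases "j = k") (auto intro: A_diff)
  let ?g = "\<lambda>\<nu>. (\<chi> k. det (\<chi> i j. if j = k then b $ i else A \<nu> $ i $ j) / det (A \<nu>)) :: real ^ 'm"
  have "?g differentiable (at \<mu>)"
    using nz[OF assms]
    by (intro differentiable_vec_nth) (auto intro!: differentiable_divide differentiable_det A_diff col)
  then obtain g' where "(?g has_derivative g') (at \<mu>)"
    by (auto simp: differentiable_def)
  then have "(u has_derivative g') (at \<mu>)"
  proof (rule has_derivative_transform_within_open[OF _ open_D assms])
    show "?g \<nu> = u \<nu>" if "\<nu> \<in> D" for \<nu>
      using cramer[OF nz[OF that]] A_u[OF that] by auto
  qed
  then show ?thesis by (auto simp: differentiable_def)
qed

text \<open>Implicit differentiation of \<open>A \<mu> *v u \<mu> = b\<close>. Pairing the result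
  with \<open>u \<mu>\<close> and using the symmetry of \<open>A \<mu>\<close> produces
  \<open>b \<bullet> u' h\<close>, which eliminates the unknown derivative
  \<open>u'\<close>.\<close>

lemma E_has_derivative:
  assumes "\<mu> \<in> D"
  shows "(E has_derivative (\<lambda>h. h \<bullet> a - (\<Sum>i\<in>UNIV. h $ i * (u \<mu> \<bullet> (M i *v u \<mu>))))) (at \<mu>)"
proof -
  obtain u' where u': "(u has_derivative u') (at \<mu>)"
    using u_differentiable[OF assms] by (auto simp: differentiable_def)
  have M_u': "((\<lambda>\<nu>. M i *v u \<nu>) has_derivative (\<lambda>h. M i *v u' h)) (at \<mu>)" for i
    by (rule bounded_linear.has_derivative[OF matrix_vector_mul_bounded_linear u'])
  have nth: "((\<lambda>\<nu>. \<nu> $ i) has_derivative (\<lambda>h. h $ i)) (at \<mu>)" for i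
    by (rule bounded_linear_imp_has_derivative[OF bounded_linear_vec_nth])
  have "((\<lambda>\<nu>. A \<nu> *v u \<nu>) has_derivative
      (\<lambda>h. \<Sum>i\<in>UNIV. (\<mu> $ i + \<delta>) *\<^sub>R (M i *v u' h) + (h $ i) *\<^sub>R (M i *v u \<mu>))) (at \<mu>)"
    unfolding A_mult by (auto intro!: derivative_eq_intros M_u' nth)
  \<comment> \<open>The product is the constant \<open>b\<close> on the open set \<open>D\<close>,
    so by uniqueness of derivatives the sum above vanishes.\<close>
  moreover have "((\<lambda>\<nu>. A \<nu> *v u \<nu>) has_derivative (\<lambda>h. 0)) (at \<mu>)"
    by (rule has_derivative_transform_within_open[OF has_derivative_const[of b] open_D assms])
      (simp add: A_u)
  ultimately have "(\<lambda>h. \<Sum>i\<in>UNIV. (\<mu> $ i + \<delta>) *\<^sub>R (M i *v u' h) + (h $ i) *\<^sub>R (M i *v u \<mu>)) = (\<lambda>h. 0)"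
    by (rule has_derivative_unique)
  then have "(\<Sum>i\<in>UNIV. (h $ i) *\<^sub>R (M i *v u \<mu>)) = - (A \<mu> *v u' h)" for h
    by (auto simp: fun_eq_iff sum.distrib A_mult eq_neg_iff_add_eq_0 add.commute)
  then have "u \<mu> \<bullet> (\<Sum>i\<in>UNIV. (h $ i) *\<^sub>R (M i *v u \<mu>)) = - (u' h \<bullet> b)" for h
    using A_adjoint[of "u \<mu>" \<mu> "u' h"] by (simp add: A_u[OF assms])
  then have eq: "b \<bullet> u' h = - (\<Sum>i\<in>UNIV. h $ i * (u \<mu> \<bullet> (M i *v u \<mu>)))" for h
    by (simp add: inner_sum_right inner_commute[of b])
  show ?thesis
    unfolding E_def by (auto intro!: derivative_eq_intros u' simp: eq)
qed

lemma grad_E: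
  assumes "\<mu> \<in> D"
  shows "grad E \<mu> = (\<chi> i. a $ i - u \<mu> \<bullet> (M i *v u \<mu>))"
proof -
  have "(\<Sum>j\<in>UNIV. axis i 1 $ j * (u \<mu> \<bullet> (M j *v u \<mu>))) = u \<mu> \<bullet> (M i *v u \<mu>)" for i
    by (simp add: axis_def if_distrib[of "\<lambda>x. x * _"] cong: if_cong)
  then show ?thesis
    by (simp add: grad_def frechet_derivative_at[OF E_has_derivative[OF assms], symmetric]
        inner_axis' vec_eq_iff)
qed

text \<open>\<open>hess\<close> is a Jacobian matrix, which represents a derivative only where one
  exists.\<close>

lemma grad_E_differentiable:
  assumes "\<mu> \<in> D"
  shows "grad E differentiable (at \<mu>)"
proof -
  let ?g = "\<lambda>\<nu>. (\<chi> i. a $ i - u \<nu> \<bullet> (M i *v u \<nu>)) :: real ^ 'n"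
  obtain u' where u': "(u has_derivative u') (at \<mu>)"
    using u_differentiable[OF assms] by (auto simp: differentiable_def)
  have M_u': "((\<lambda>\<nu>. M i *v u \<nu>) has_derivative (\<lambda>h. M i *v u' h)) (at \<mu>)" for i
    by (rule bounded_linear.has_derivative[OF matrix_vector_mul_bounded_linear u'])
  have "?g differentiable (at \<mu>)"
    by (rule differentiable_vec_nth)
      (auto simp: differentiable_def intro!: exI derivative_eq_intros u' M_u')
  then obtain g' where "(?g has_derivative g') (at \<mu>)"
    by (auto simp: differentiable_def)
  then have "(grad E has_derivative g') (at \<mu>)"
    by (rule has_derivative_transform_within_open[OF _ open_D assms]) (simp add: grad_E)
  then show ?thesis by (auto simp: differentiable_def)
qed

text \<open>If \<open>v\<close> does not change the equation solved by \<open>u \<mu>\<close>, then \<open>u\<close>, and with it the gradient,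
  is constant on the line through \<open>\<mu>\<close> in direction \<open>v\<close>.\<close>

lemma hess_E_kernel:
  assumes "\<mu> \<in> D" and v: "(\<Sum>i\<in>UNIV. (v $ i) *\<^sub>R (M i *v u \<mu>)) = 0"
  shows "hess E \<mu> *v v = 0"
proof -
  \<comment> \<open>The derivative of the gradient along this line is computed twice: by the chain
    rule, and as that of a map constant near \<open>0\<close>.\<close>
  let ?l = "\<lambda>t::real. \<mu> + t *\<^sub>R v"
  have l: "(?l has_derivative (\<lambda>t. t *\<^sub>R v)) (at 0)"
    by (auto intro!: derivative_eq_intros)
  have "(grad E has_derivative (\<lambda>h. hess E \<mu> *v h)) (at (?l 0))"
    using grad_E_differentiable[OF assms(1)] by (simp add: jacobian_works hess_def)
  from diff_chain_at[OF l this]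
  have "((\<lambda>t. grad E (?l t)) has_derivative (\<lambda>t. hess E \<mu> *v (t *\<^sub>R v))) (at 0)"
    by (simp add: o_def)
  moreover have "((\<lambda>t. grad E (?l t)) has_derivative (\<lambda>t. 0)) (at 0)"
  proof (rule has_derivative_transform_within_open)
    show "((\<lambda>t. grad E \<mu>) has_derivative (\<lambda>t. 0)) (at (0::real))" by simp
    show "open (?l -` D)"
      by (rule open_vimage[OF open_D]) (auto intro!: continuous_intros)
    show "0 \<in> ?l -` D" using assms(1) by simp
    show "grad E \<mu> = grad E (?l t)" if "t \<in> ?l -` D" for t
    proof -
      \<comment> \<open>\<open>A\<close> is affine in \<open>\<mu>\<close>, so moving along the line
        only adds \<open>t\<close> times the sum that vanishes by \<open>v\<close>.\<close>
      have "A (?l t) *v u \<mu> = A \<mu> *v u \<mu> + t *\<^sub>R (\<Sum>i\<in>UNIV. (v $ i) *\<^sub>R (M i *v u \<mu>))"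
        by (simp add: A_mult scaleR_sum_right flip: sum.distrib) (simp add: algebra_simps)
      then have "A (?l t) *v u \<mu> = b"
        by (simp add: v A_u[OF assms(1)])
      then have "u (?l t) = u \<mu>"
        using that by (intro u_unique) auto
      then show ?thesis
        using that assms(1) by (simp add: grad_E)
    qed
  qed
  ultimately have "(\<lambda>t. hess E \<mu> *v (t *\<^sub>R v)) = (\<lambda>t::real. 0)"
    by (rule has_derivative_unique)
  from fun_cong[OF this, of 1] show ?thesis by simp
qed

text \<open>For fixed \<open>w\<close> the first two terms are affine in \<open>\<mu>\<close> and
  the last is nonnegative: the compliance lies above these affine functions and touches them where
  \<open>u \<mu> = w\<close>, which is its convexity with an explicit gap.\<close>

lemma complete_square:
  assumes "\<mu> \<in> D"
  shows "b \<bullet> u \<mu> = 2 * (b \<bullet> w) - w \<bullet> (A \<mu> *v w) + (w - u \<mu>) \<bullet> (A \<mu> *v (w - u \<mu>))"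
  using A_adjoint[of "u \<mu>" \<mu> w] A_u[OF assms]
  by (simp add: matrix_vector_mult_diff_distrib inner_diff_left inner_diff_right inner_commute)

text \<open>At the midpoint of two minimizers convexity must hold with equality, so by
  \<open>complete_square\<close> both have the same solution \<open>u\<close>.\<close>

lemma minimizers_same_u:
  assumes "\<mu> \<in> D" "\<nu> \<in> D" "midpoint \<mu> \<nu> \<in> D"
    and "E \<mu> \<le> E (midpoint \<mu> \<nu>)" and "E \<nu> \<le> E (midpoint \<mu> \<nu>)"
  shows "u \<mu> = u \<nu>"
proof -
  define m where "m = midpoint \<mu> \<nu>"
  have avg: "m $ i + \<delta> = (1/2) * (\<mu> $ i + \<delta>) + (1/2) * (\<nu> $ i + \<delta>)" for i
    by (simp add: m_def midpoint_def field_simps)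
  have "A m *v u m = (1/2) *\<^sub>R (A \<mu> *v u m + A \<nu> *v u m)"
    unfolding A_mult avg
    by (simp only: distrib_left scaleR_add_left sum.distrib scaleR_add_right scaleR_sum_right
        scaleR_scaleR add_ac)
  then have "u m \<bullet> (A m *v u m) = (u m \<bullet> (A \<mu> *v u m) + u m \<bullet> (A \<nu> *v u m)) / 2"
    by (simp add: inner_add_right)
  moreover have "m \<bullet> a = (\<mu> \<bullet> a + \<nu> \<bullet> a) / 2"
    by (simp add: m_def midpoint_def inner_add_left)
  moreover have "b \<bullet> u m = 2 * (b \<bullet> u m) - u m \<bullet> (A m *v u m)"
    using complete_square[of m "u m"] assms(3) by (simp add: m_def)
  \<comment> \<open>With \<open>w = u m\<close> the affine parts at the two endpoints average to
    \<open>E m\<close>, so \<open>E \<mu> + E \<nu>\<close> is \<open>2 * E m\<close> plus both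
    gaps.\<close>
  ultimately have "(u m - u \<mu>) \<bullet> (A \<mu> *v (u m - u \<mu>)) + (u m - u \<nu>) \<bullet> (A \<nu> *v (u m - u \<nu>)) \<le> 0"
    using assms(4,5) complete_square[OF assms(1), of "u m"] complete_square[OF assms(2), of "u m"]
    by (simp add: E_def flip: m_def)
  then have "u m - u \<mu> = 0 \<and> u m - u \<nu> = 0"
    using A_pos[OF assms(1), of "u m - u \<mu>"] A_pos[OF assms(2), of "u m - u \<nu>"]
    by (smt (verit) inner_zero_left)
  then show ?thesis by auto
qed

text \<open>The common solution satisfies the equations at \<open>\<mu>\<close> and at
  \<open>\<nu>\<close>; subtracting them cancels the shift \<open>\<delta>\<close> and leaves the
  condition of \<open>hess_E_kernel\<close> for \<open>\<nu> - \<mu>\<close>.\<close>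

lemma minimizers_hess_kernel:
  assumes "\<mu> \<in> D" "\<nu> \<in> D" "midpoint \<mu> \<nu> \<in> D"
    and "E \<mu> \<le> E (midpoint \<mu> \<nu>)" and "E \<nu> \<le> E (midpoint \<mu> \<nu>)"
  shows "hess E \<mu> *v (\<nu> - \<mu>) = 0"
proof (rule hess_E_kernel[OF assms(1)])
  have "(\<Sum>i\<in>UNIV. ((\<nu> - \<mu>) $ i) *\<^sub>R (M i *v u \<mu>)) = A \<nu> *v u \<mu> - A \<mu> *v u \<mu>"
    by (simp add: A_mult flip: sum_subtractf scaleR_left_diff_distrib)
  then show "(\<Sum>i\<in>UNIV. ((\<nu> - \<mu>) $ i) *\<^sub>R (M i *v u \<mu>)) = 0"
    using A_u[OF assms(1)] A_u[OF assms(2)] minimizers_same_u[OF assms] by simp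
qed

end

section \<open>Stiffness matrices of piecewise affine functions\<close>

lemma simplex_interior_nonempty:
  fixes T :: "(real ^ 'd) set"
  assumes "int CARD('d) simplex T"
  shows "interior T \<noteq> {}"
proof -
  have "interior T = rel_interior T"
    using aff_dim_simplex[OF assms] by (simp add: interior_rel_interior_gen)
  moreover have "T \<noteq> {}"
    using assms by auto
  ultimately show ?thesis
    using convex_simplex[OF assms] by (simp add: rel_interior_eq_empty)
qed

lemma open_unit_cube: "open (unit_cube :: (real ^ 'd) set)"
  by (simp add: unit_cube_def open_box)

lemma convex_unit_cube: "convex (unit_cube :: (real ^ 'd) set)"
  by (simp add: unit_cube_def convex_box)

lemma unit_cube_nonempty: "(unit_cube :: (real ^ 'd) set) \<noteq> {}"
  by (simp add: unit_cube_def interval_ne_empty_cart)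

lemma bounded_unit_cube: "bounded (unit_cube :: (real ^ 'd) set)"
  by (simp add: unit_cube_def bounded_box)

lemma lmeasurable_unit_cube: "(unit_cube :: (real ^ 'd) set) \<in> lmeasurable"
  by (simp add: unit_cube_def)

section \<open>Gradients and integrability of piecewise affine functions\<close>

lemma grad_affine:
  assumes "open V" "x \<in> V" "\<And>y. y \<in> V \<Longrightarrow> u y = a \<bullet> y + b"
  shows "grad u x = a"
proof -
  have "((\<lambda>y. a \<bullet> y + b) has_derivative (\<lambda>h. a \<bullet> h)) (at x)"
    by (auto intro!: derivative_eq_intros)
  then have "(u has_derivative (\<lambda>h. a \<bullet> h)) (at x)"
    by (rule has_derivative_transform_within_open[OF _ assms(1,2)]) (simp add: assms(3))
  from frechet_derivative_at[OF this, symmetric] show ?thesis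
    by (simp add: grad_def inner_axis vec_eq_iff)
qed

text \<open>On the open union of the cell interiors \<open>h\<close> is locally constant, hence
  continuous, and bounded by the sum of all \<open>\<bar>k S\<bar>\<close>; the rest of
  \<open>T\<close> is a null set.\<close>

lemma set_integrable_piecewise_constant:
  fixes h :: "'a::euclidean_space \<Rightarrow> real"
  assumes fin: "finite \<T>" and h: "\<And>S x. S \<in> \<T> \<Longrightarrow> x \<in> interior S \<Longrightarrow> h x = k S"
    and T: "T \<in> lmeasurable" and null: "negligible (T - (\<Union>S\<in>\<T>. interior S))"
  shows "set_integrable lebesgue T h"
proof -
  define U where "U = (\<Union>S\<in>\<T>. interior S)"
  have "continuous_on U h"
    unfolding U_def
  proof (rule continuous_on_open_UN)
    show "continuous_on (interior S) h" if "S \<in> \<T>" for S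
      using continuous_on_const[of "interior S" "k S"]
      by (rule continuous_on_eq) (simp add: h[OF that])
  qed simp
  then have "(\<lambda>x. indicator U x *\<^sub>R h x) \<in> borel_measurable borel"
    by (intro borel_measurable_continuous_on_indicator) (auto simp: U_def intro!: borel_open)
  then have meas: "(\<lambda>x. indicator U x *\<^sub>R h x) \<in> borel_measurable lebesgue"
    by (simp add: measurable_completion)
  have bound: "norm (indicator U x *\<^sub>R h x) \<le> (\<Sum>S\<in>\<T>. \<bar>k S\<bar>)" for x
  proof (cases "x \<in> U")
    case True
    then obtain S where S: "S \<in> \<T>" "x \<in> interior S" by (auto simp: U_def)
    then have "\<bar>h x\<bar> \<le> (\<Sum>S\<in>\<T>. \<bar>k S\<bar>)"
      using member_le_sum[of S \<T> "\<lambda>S. \<bar>k S\<bar>"] fin by (simp add: h[OF S])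
    then show ?thesis using True by simp
  qed (simp add: sum_nonneg)
  have "set_integrable lebesgue T (\<lambda>x. indicator U x *\<^sub>R h x)"
    unfolding set_integrable_def using T
    by (intro integrableI_bounded_set_indicator[OF _ meas, of _ "\<Sum>S\<in>\<T>. \<bar>k S\<bar>"])
      (use bound in \<open>auto simp: fmeasurable_def\<close>)
  then show ?thesis
    by (rule absolutely_integrable_spike[OF _ null]) (auto simp: U_def)
qed

text \<open>By bilinearity, the quadratic form is the Dirichlet energy on \<open>T\<close> of the
  combination of the \<open>\<phi> p\<close> with coefficients \<open>w\<close>.\<close>

lemma stiffness_quadratic_form:
  assumes "\<And>p q. set_integrable lebesgue T (\<lambda>x. grad (\<phi> p) x \<bullet> grad (\<phi> q) x)"
  shows "set_integrable lebesgue T (\<lambda>x. (norm (\<Sum>p\<in>UNIV. (w $ p) *\<^sub>R grad (\<phi> p) x))\<^sup>2)"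
    and "w \<bullet> (stiffness \<phi> T *v w) =
      (LINT x:T|lebesgue. (norm (\<Sum>p\<in>UNIV. (w $ p) *\<^sub>R grad (\<phi> p) x))\<^sup>2)"
proof -
  define K where "K p q x = indicator T x *\<^sub>R (grad (\<phi> p) x \<bullet> grad (\<phi> q) x)" for p q x
  have expand: "indicator T x *\<^sub>R (norm (\<Sum>p\<in>UNIV. (w $ p) *\<^sub>R grad (\<phi> p) x))\<^sup>2 =
      (\<Sum>p\<in>UNIV. \<Sum>q\<in>UNIV. (w $ p * w $ q) * K p q x)" for x
    by (simp add: K_def power2_norm_eq_inner inner_sum_left inner_sum_right sum_distrib_left
        inner_commute mult_ac)
  have int: "integrable lebesgue (K p q)" for p q
    using assms[of p q] by (simp add: set_integrable_def K_def[abs_def])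
  show "set_integrable lebesgue T (\<lambda>x. (norm (\<Sum>p\<in>UNIV. (w $ p) *\<^sub>R grad (\<phi> p) x))\<^sup>2)"
    unfolding set_integrable_def expand
    by (intro Bochner_Integration.integrable_sum integrable_mult_right int)
  have "stiffness \<phi> T $ p $ q = (LINT x|lebesgue. K p q x)" for p q
    by (simp add: stiffness_def set_lebesgue_integral_def K_def)
  then have "(LINT x:T|lebesgue. (norm (\<Sum>p\<in>UNIV. (w $ p) *\<^sub>R grad (\<phi> p) x))\<^sup>2) =
      (\<Sum>p\<in>UNIV. \<Sum>q\<in>UNIV. (w $ p * w $ q) * stiffness \<phi> T $ p $ q)"
    unfolding set_lebesgue_integral_def expand by (simp add: Bochner_Integration.integral_sum int)
  then show "w \<bullet> (stiffness \<phi> T *v w) =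
      (LINT x:T|lebesgue. (norm (\<Sum>p\<in>UNIV. (w $ p) *\<^sub>R grad (\<phi> p) x))\<^sup>2)"
    by (simp add: inner_vec_def matrix_vector_mult_def sum_distrib_left mult_ac)
qed

lemma transpose_stiffness: "transpose (stiffness \<phi> T) = stiffness \<phi> T"
  by (simp add: transpose_def stiffness_def inner_commute)

section \<open>Piecewise affine functions of zero mean on a triangulation\<close>

locale p1_family =
  fixes \<T> :: "(real ^ 'd) set set" and \<phi> :: "'m::finite \<Rightarrow> real ^ 'd \<Rightarrow> real"
  assumes tri: "triangulation_of_cube \<T>" and p1: "range \<phi> \<subseteq> P1_zero_mean \<T>"
begin

lemma finite_mesh: "finite \<T>"
  using tri by (simp add: triangulation_of_cube_def triangulation_def)

lemma mesh_simplex: "S \<in> \<T> \<Longrightarrow> int CARD('d) simplex S"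
  using tri by (simp add: triangulation_of_cube_def)

lemma Union_mesh: "\<Union>\<T> = closure unit_cube"
  using tri by (simp add: triangulation_of_cube_def)

text \<open>An open convex set is the interior of its closure.\<close>

lemma interior_mesh: "S \<in> \<T> \<Longrightarrow> interior S \<subseteq> unit_cube"
  using interior_mono[of S "closure unit_cube"] Union_mesh
  by (auto simp: convex_interior_closure[OF convex_unit_cube] interior_open[OF open_unit_cube])

lemma negligible_skeleton: "negligible (closure unit_cube - (\<Union>S\<in>\<T>. interior S))"
proof (rule negligible_subset)
  show "negligible (\<Union>(frontier ` \<T>))"
    using finite_mesh
    by (auto intro!: negligible_Union negligible_convex_frontier convex_simplex mesh_simplex)
  show "closure unit_cube - (\<Union>S\<in>\<T>. interior S) \<subseteq> \<Union>(frontier ` \<T>)"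
    unfolding Union_mesh[symmetric]
    using closed_simplex[OF mesh_simplex] by (auto simp: frontier_def)
qed

text \<open>\<open>slope\<close> is chosen first and \<open>offset\<close> afterwards relative to
  it, so that both belong to the same affine representation on \<open>S\<close>.\<close>

definition slope :: "'m \<Rightarrow> (real ^ 'd) set \<Rightarrow> real ^ 'd" where
  "slope p S = (SOME a. \<exists>b. \<forall>x\<in>S \<inter> unit_cube. \<phi> p x = a \<bullet> x + b)"

definition offset :: "'m \<Rightarrow> (real ^ 'd) set \<Rightarrow> real" where
  "offset p S = (SOME b. \<forall>x\<in>S \<inter> unit_cube. \<phi> p x = slope p S \<bullet> x + b)"

lemma phi_affine:
  assumes "S \<in> \<T>" "x \<in> S" "x \<in> unit_cube"
  shows "\<phi> p x = slope p S \<bullet> x + offset p S"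
proof -
  have "\<exists>a b. \<forall>x\<in>S \<inter> unit_cube. \<phi> p x = a \<bullet> x + b"
    using p1 assms(1) by (fastforce simp: P1_zero_mean_def)
  then have "\<exists>b. \<forall>x\<in>S \<inter> unit_cube. \<phi> p x = slope p S \<bullet> x + b"
    unfolding slope_def by (rule someI_ex)
  then have "\<forall>x\<in>S \<inter> unit_cube. \<phi> p x = slope p S \<bullet> x + offset p S"
    unfolding offset_def by (rule someI_ex)
  then show ?thesis using assms by blast
qed

lemma grad_phi:
  assumes "S \<in> \<T>" "x \<in> interior S"
  shows "grad (\<phi> p) x = slope p S"
  using assms interior_mesh[OF assms(1)] interior_subset[of S]
  by (intro grad_affine[of "interior S"]) (auto intro: phi_affine)

lemma phi_continuous: "continuous_on unit_cube (\<phi> p)"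
  using p1 by (fastforce simp: P1_zero_mean_def)

lemma phi_mean: "(LINT x:unit_cube|lebesgue. \<phi> p x) = 0"
  using p1 by (fastforce simp: P1_zero_mean_def)

text \<open>\<open>T\<close> is a general compact set since the integrals run over simplices of the
  coarse mesh, whereas gradients are constant on cells of the fine one.\<close>

lemma grad_products_integrable:
  assumes "compact T" "T \<subseteq> closure unit_cube"
  shows "set_integrable lebesgue T (\<lambda>x. grad (\<phi> p) x \<bullet> grad (\<phi> q) x)"
proof (rule set_integrable_piecewise_constant[OF finite_mesh])
  show "grad (\<phi> p) x \<bullet> grad (\<phi> q) x = slope p S \<bullet> slope q S" if "S \<in> \<T>" "x \<in> interior S" for S x
    using that by (simp add: grad_phi)
  show "T \<in> lmeasurable" using assms(1) by (rule lmeasurable_compact)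
  show "negligible (T - (\<Union>S\<in>\<T>. interior S))"
    by (rule negligible_subset[OF negligible_skeleton]) (use assms(2) in auto)
qed

text \<open>Not implied by zero mean: the integral of a non-integrable function is \<open>0\<close> by convention.\<close>

lemma phi_integrable: "set_integrable lebesgue unit_cube (\<phi> p)"
proof -
  obtain C where C: "\<And>x. x \<in> unit_cube \<Longrightarrow> norm (x :: real ^ 'd) \<le> C"
    using bounded_unit_cube by (auto simp: bounded_iff)
  \<comment> \<open>Cauchy-Schwarz bound for the affine piece on \<open>S\<close>;
    \<open>\<bar>C\<bar>\<close> makes it nonnegative, so that one summand is at most the whole
    sum.\<close>
  define B where "B S = norm (slope p S) * \<bar>C\<bar> + \<bar>offset p S\<bar>" for S
  have "\<bar>\<phi> p x\<bar> \<le> (\<Sum>S\<in>\<T>. B S)" if x: "x \<in> unit_cube" for x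
  proof -
    obtain S where S: "S \<in> \<T>" "x \<in> S"
      using x closure_subset Union_mesh by blast
    have "\<bar>slope p S \<bullet> x\<bar> \<le> norm (slope p S) * norm x"
      by (rule Cauchy_Schwarz_ineq2)
    also have "\<dots> \<le> norm (slope p S) * \<bar>C\<bar>"
      using C[OF x] by (intro mult_left_mono) auto
    finally have "\<bar>\<phi> p x\<bar> \<le> B S"
      unfolding B_def phi_affine[OF S x] by linarith
    also have "\<dots> \<le> (\<Sum>S\<in>\<T>. B S)"
      using S finite_mesh by (intro member_le_sum) (auto simp: B_def)
    finally show ?thesis .
  qed
  then have bound: "norm (indicator unit_cube x *\<^sub>R \<phi> p x) \<le> (\<Sum>S\<in>\<T>. B S)" if "x \<in> unit_cube" for x
    using that by simp
  have "(\<lambda>x. indicator unit_cube x *\<^sub>R \<phi> p x) \<in> borel_measurable borel"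
    by (intro borel_measurable_continuous_on_indicator phi_continuous borel_open open_unit_cube)
  then have meas: "(\<lambda>x. indicator unit_cube x *\<^sub>R \<phi> p x) \<in> borel_measurable lebesgue"
    by (simp add: measurable_completion)
  have "integrable lebesgue (\<lambda>x. indicator unit_cube x *\<^sub>R \<phi> p x)"
    by (rule integrableI_bounded_set[OF _ meas, of unit_cube "\<Sum>S\<in>\<T>. B S"])
      (use lmeasurable_unit_cube bound in \<open>auto simp: fmeasurable_def\<close>)
  then show ?thesis by (simp add: set_integrable_def)
qed

lemma zero_gradient_imp_zero:
  assumes slope: "\<And>S. S \<in> \<T> \<Longrightarrow> (\<Sum>p\<in>UNIV. (w $ p) *\<^sub>R slope p S) = 0"
    and x: "x \<in> unit_cube"
  shows "(\<Sum>p\<in>UNIV. w $ p * \<phi> p x) = 0"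
proof -
  define u where "u x = (\<Sum>p\<in>UNIV. w $ p * \<phi> p x)" for x
  have piece: "u x = (\<Sum>p\<in>UNIV. w $ p * offset p S)" if "S \<in> \<T>" "x \<in> S" "x \<in> unit_cube" for S x
  proof -
    have "u x = (\<Sum>p\<in>UNIV. (w $ p) *\<^sub>R slope p S) \<bullet> x + (\<Sum>p\<in>UNIV. w $ p * offset p S)"
      by (simp add: u_def phi_affine[OF that] inner_sum_left distrib_left sum.distrib)
    then show ?thesis by (simp add: slope[OF that(1)])
  qed
  \<comment> \<open>One value per cell: the image is finite, and being connected it is a single
    point.\<close>
  have "u ` unit_cube \<subseteq> (\<lambda>S. \<Sum>p\<in>UNIV. w $ p * offset p S) ` \<T>"
  proof (rule image_subsetI)
    fix x :: "real ^ 'd" assume x: "x \<in> unit_cube"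
    then obtain S where "S \<in> \<T>" "x \<in> S"
      using closure_subset Union_mesh by blast
    then show "u x \<in> (\<lambda>S. \<Sum>p\<in>UNIV. w $ p * offset p S) ` \<T>"
      using piece x by blast
  qed
  then have "finite (u ` unit_cube)"
    using finite_mesh finite_subset by blast
  moreover have "connected (u ` unit_cube)"
  proof (rule connected_continuous_image)
    show "continuous_on unit_cube u"
      unfolding u_def
      by (intro continuous_on_sum continuous_on_mult continuous_on_const phi_continuous)
    show "connected (unit_cube :: (real ^ 'd) set)"
      by (rule convex_connected[OF convex_unit_cube])
  qed
  ultimately obtain k where k: "u ` unit_cube = {k}"
    using connected_finite_iff_sing unit_cube_nonempty by (metis image_is_empty)
  have "(LINT x:unit_cube|lebesgue. u x) = (\<Sum>p\<in>UNIV. w $ p * (LINT x:unit_cube|lebesgue. \<phi> p x))"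
  proof -
    define K where "K p x = indicator unit_cube x *\<^sub>R \<phi> p x" for p x
    have "integrable lebesgue (K p)" for p
      using phi_integrable[of p] by (simp add: set_integrable_def K_def[abs_def])
    then have "(LINT x|lebesgue. (\<Sum>p\<in>UNIV. w $ p * K p x)) =
        (\<Sum>p\<in>UNIV. w $ p * (LINT x|lebesgue. K p x))"
      by (simp add: Bochner_Integration.integral_sum)
    moreover have "indicator unit_cube x *\<^sub>R u x = (\<Sum>p\<in>UNIV. w $ p * K p x)" for x
      by (simp add: u_def K_def sum_distrib_left)
    ultimately show ?thesis
      by (simp add: set_lebesgue_integral_def K_def del: real_scaleR_def)
  qed
  then have "(LINT x:unit_cube|lebesgue. u x) = 0"
    by (simp add: phi_mean)
  moreover have "(LINT x:unit_cube|lebesgue. u x) = (LINT x:(unit_cube :: (real ^ 'd) set)|lebesgue. k)"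
    using k lmeasurable_unit_cube by (intro set_lebesgue_integral_cong) (auto simp: fmeasurable_def)
  moreover have "\<dots> = measure lebesgue (unit_cube :: (real ^ 'd) set) * k"
    using lmeasurable_unit_cube[where 'd = 'd]
    by (subst set_integral_const) (auto simp: fmeasurable_def)
  \<comment> \<open>The zero mean of \<open>u\<close> equals \<open>k\<close> times the volume of
    the cube, which is nonzero.\<close>
  moreover have "measure lebesgue (unit_cube :: (real ^ 'd) set) \<noteq> 0"
    using open_not_negligible[OF open_unit_cube unit_cube_nonempty]
      negligible_iff_measure0[OF lmeasurable_unit_cube] by blast
  ultimately have "k = 0" by simp
  then show ?thesis using k x by (auto simp: u_def)
qed

text \<open>The gradient is constant on the interior of \<open>S\<close>, a nonempty open set and
  thus not null.\<close>

lemma AE_gradient_zero_imp_slope_zero: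
  assumes "AE x in lebesgue. x \<in> closure unit_cube \<longrightarrow> (\<Sum>p\<in>UNIV. (w $ p) *\<^sub>R grad (\<phi> p) x) = 0"
    and S: "S \<in> \<T>"
  shows "(\<Sum>p\<in>UNIV. (w $ p) *\<^sub>R slope p S) = 0"
proof (rule ccontr)
  assume nz: "(\<Sum>p\<in>UNIV. (w $ p) *\<^sub>R slope p S) \<noteq> 0"
  obtain N where N: "N \<in> null_sets lebesgue"
    "{x. \<not> (x \<in> closure unit_cube \<longrightarrow> (\<Sum>p\<in>UNIV. (w $ p) *\<^sub>R grad (\<phi> p) x) = 0)} \<subseteq> N"
    using assms(1) unfolding eventually_ae_filter by (elim bexE) (rule that, auto)
  have "interior S \<subseteq> N"
  proof
    fix x assume x: "x \<in> interior S"
    then have "x \<in> closure unit_cube"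
      using interior_mesh[OF S] closure_subset by blast
    then show "x \<in> N"
      using nz N(2) by (auto simp: grad_phi[OF S x])
  qed
  then have "negligible (interior S)"
    using N(1) negligible_iff_null_sets negligible_subset by blast
  then show False
    using open_not_negligible simplex_interior_nonempty[OF mesh_simplex[OF S]] by blast
qed

text \<open>The integrals of the squared gradient vanish over each member of the cover
  \<open>\<C>\<close>, so the gradient vanishes almost everywhere on the cube, hence on every cell
  of \<open>\<T>\<close>.\<close>

lemma stiffness_definite:
  assumes indep: "\<And>c. (\<And>x. x \<in> unit_cube \<Longrightarrow> (\<Sum>p\<in>UNIV. c p * \<phi> p x) = 0) \<Longrightarrow> (\<And>p. c p = 0)"
    and \<C>: "finite \<C>" "\<And>T. T \<in> \<C> \<Longrightarrow> compact T" "\<Union>\<C> = closure unit_cube"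
    and zero: "\<And>T. T \<in> \<C> \<Longrightarrow> w \<bullet> (stiffness \<phi> T *v w) = 0"
  shows "w = 0"
proof -
  let ?G = "\<lambda>x. \<Sum>p\<in>UNIV. (w $ p) *\<^sub>R grad (\<phi> p) x"
  have "AE x in lebesgue. x \<in> T \<longrightarrow> ?G x = 0" if "T \<in> \<C>" for T
  proof -
    have int: "set_integrable lebesgue T (\<lambda>x. grad (\<phi> p) x \<bullet> grad (\<phi> q) x)" for p q
      using \<C> that by (intro grad_products_integrable) auto
    have "(LINT x|lebesgue. indicator T x *\<^sub>R (norm (?G x))\<^sup>2) = 0"
      using zero[OF that] stiffness_quadratic_form(2)[OF int, of w]
      by (simp add: set_lebesgue_integral_def)
    moreover have "integrable lebesgue (\<lambda>x. indicator T x *\<^sub>R (norm (?G x))\<^sup>2)"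
      using stiffness_quadratic_form(1)[OF int, of w] by (simp add: set_integrable_def)
    ultimately have "AE x in lebesgue. indicator T x *\<^sub>R (norm (?G x))\<^sup>2 = 0"
      by (subst (asm) integral_nonneg_eq_0_iff_AE) auto
    then show ?thesis by eventually_elim (auto simp: indicator_def)
  qed
  then have "AE x in lebesgue. \<forall>T\<in>\<C>. x \<in> T \<longrightarrow> ?G x = 0"
    by (rule AE_finite_allI[OF \<C>(1)])
  then have "AE x in lebesgue. x \<in> closure unit_cube \<longrightarrow> ?G x = 0"
    by eventually_elim (auto simp flip: \<C>(3))
  then have "(\<Sum>p\<in>UNIV. (w $ p) *\<^sub>R slope p S) = 0" if "S \<in> \<T>" for S
    using that by (rule AE_gradient_zero_imp_slope_zero)
  then have "w $ p = 0" for p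
    by (intro indep[of "\<lambda>p. w $ p"] zero_gradient_imp_zero) auto
  then show ?thesis by (simp add: vec_eq_iff)
qed

end

section \<open>Uniqueness of the minimizer\<close>

theorem proposition3p2:
  fixes f :: "real ^ 'd \<Rightarrow> real"
    and \<T> :: "nat \<Rightarrow> (real ^ 'd) set set"
    and \<delta> :: "nat \<Rightarrow> real"
    and n :: nat
    and \<tau> :: "'n::finite \<Rightarrow> (real ^ 'd) set"
    and \<phi> :: "'m::finite \<Rightarrow> real ^ 'd \<Rightarrow> real"
    and \<mu>' :: "real ^ 'n"
  assumes "L_infinity_on unit_cube f"
    and "(LINT x:unit_cube|lebesgue. f x) = 0"
    and "compactly_contained (convex hull (ess_support_on unit_cube f)) unit_cube"
    and "\<And>k. triangulation_of_cube (\<T> k)"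
    and "\<And>k. uniform_refinement (\<T> k) (\<T> (Suc k))"
    and "\<And>k. \<delta> k > 0" and "decseq \<delta>" and "\<delta> \<longlonglongrightarrow> 0"
    and "bij_betw \<tau> UNIV (\<T> n)"
    and "basis_on unit_cube (P1_zero_mean (\<T> (Suc n))) \<phi>"
    and "\<mu>' \<in> argmin_on nonneg_orthant (energy \<tau> \<phi> (\<delta> n) f)"
    and "{\<mu>' + v | v. hess (energy_formula \<tau> \<phi> (\<delta> n) f) \<mu>' *v v = 0} \<inter> nonneg_orthant = {\<mu>'}"
  shows "argmin_on nonneg_orthant (energy \<tau> \<phi> (\<delta> n) f) = {\<mu>'}"
proof -
  note bij = assms(9) and basis = assms(10) and min = assms(11)
    and kernel = assms(12)
  interpret mesh: p1_family "\<T> (Suc n)" \<phi>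
    using assms(4)[of "Suc n"] basis by unfold_locales (auto simp: basis_on_def)
  have \<T>n: "\<T> n = range \<tau>"
    using bij by (simp add: bij_betw_def)
  have cpt: "compact (\<tau> i)" and sub: "\<tau> i \<subseteq> closure unit_cube" for i
    using assms(4)[of n] compact_simplex[of "int CARD('d)" "\<tau> i"]
    by (auto simp: triangulation_of_cube_def \<T>n)
  interpret pencil: stiffness_pencil "\<lambda>i. stiffness \<phi> (\<tau> i)" "\<delta> n" "load \<phi> f" "volumes \<tau>"
  proof
    show "transpose (stiffness \<phi> (\<tau> i)) = stiffness \<phi> (\<tau> i)" for i
      by (rule transpose_stiffness)
    show "0 \<le> w \<bullet> (stiffness \<phi> (\<tau> i) *v w)" for i w
      by (subst stiffness_quadratic_form(2)[OF mesh.grad_products_integrable[OF cpt sub]])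
        (auto simp: set_lebesgue_integral_def intro!: Bochner_Integration.integral_nonneg)
    show "w = 0" if "\<And>i. w \<bullet> (stiffness \<phi> (\<tau> i) *v w) = 0" for w
    proof (rule mesh.stiffness_definite[of "\<T> n"])
      show "c p = 0" if "\<And>x. x \<in> unit_cube \<Longrightarrow> (\<Sum>p\<in>UNIV. c p * \<phi> p x) = 0" for c p
        using basis that by (simp add: basis_on_def)
      show "\<Union>(\<T> n) = closure unit_cube"
        using assms(4)[of n] by (simp add: triangulation_of_cube_def)
    qed (use that cpt in \<open>auto simp: \<T>n\<close>)
    show "0 < \<delta> n" by (rule assms(6))
  qed
  have E: "energy_formula \<tau> \<phi> (\<delta> n) f = pencil.E"
    by (simp add: fun_eq_iff energy_formula_def weighted_stiffness_def pencil.E_def pencil.u_def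
        pencil.A_def)
  \<comment> \<open>On the orthant \<open>energy\<close> is finite, so comparing extended reals
    reduces to comparing values of \<open>pencil.E\<close>.\<close>
  have argmin: "\<mu> \<in> argmin_on nonneg_orthant (energy \<tau> \<phi> (\<delta> n) f) \<longleftrightarrow>
      \<mu> \<in> nonneg_orthant \<and> (\<forall>\<nu>\<in>nonneg_orthant. pencil.E \<mu> \<le> pencil.E \<nu>)" for \<mu>
    by (auto simp: argmin_on_def is_arg_min_def energy_def E not_less)
  have "\<nu> = \<mu>'" if \<nu>: "\<nu> \<in> argmin_on nonneg_orthant (energy \<tau> \<phi> (\<delta> n) f)" for \<nu>
  proof -
    have orthant: "\<mu>' \<in> nonneg_orthant" "\<nu> \<in> nonneg_orthant"
      using min \<nu> by (auto simp: argmin)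
    \<comment> \<open>The midpoint is thus an admissible competitor, and neither minimizer exceeds
      its energy.\<close>
    then have mid: "midpoint \<mu>' \<nu> \<in> nonneg_orthant"
      by (auto simp: nonneg_orthant_def midpoint_def)
    have "hess pencil.E \<mu>' *v (\<nu> - \<mu>') = 0"
      using min \<nu> orthant mid pencil.nonneg_orthant_subset_D
      by (intro pencil.minimizers_hess_kernel) (auto simp: argmin)
    then have "\<mu>' + (\<nu> - \<mu>') \<in> {\<mu>' + v | v. hess (energy_formula \<tau> \<phi> (\<delta> n) f) \<mu>' *v v = 0}"
      unfolding E by blast
    then have "\<nu> \<in> {\<mu>'}"
      using orthant(2) by (simp flip: kernel)
    then show ?thesis by simp
  qed
  then show ?thesis using min by blast
qed

end
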